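(* Consider the program \[ J^*=\sup_{q,\,v}\ \int_X q(x)\,d\varphi(x) \] subject to \[ \begin{aligned} & q(x)\le v(0,x,z) && \forall (x,z)\in X\times[0,J_{\max}],\\ & q(x)\le Q_{\max} && \forall x\in\operatorname{supp}(\varphi),\\ & z\ge v(t,x,z) && \forall (t,x,z)\in[0,T]\times X_u\times Z,\\ & \mathcal{L}_f v(t,x,z,w)\ge0 && \forall (t,x,z,w)\in[0,T]\times X\times\Omega\ \ (\text{i.e. }(w,z)\in\Omega),\\ & v\in C^1([0,T]\times X\times Z),\quad q\in C(X). \end{aligned} \] This program provides a subvalue function: every feasible $(q,v)$ satisfies $q(x)\le Q(x)$ for all $x\in X$, where \[ Q(x')=\inf_{z\in[0,J_{\max}]}V(x',z), \] \[ V(x',z)=\begin{cases} z & \text{if } z\in[0,J_{\max}] \text{ and } \exists\, t\in[0,T],\ w(\cdot)\in\mathcal{W}:\ x(t\mid x',w(\cdot))\in X_u,\ J(w(t'))\le z\ \forall t'\in[0,t],\\ \infty & \text{otherwise.}\end{cases} \]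
   Context: Let $T>0$, let $X\subset\mathbb{R}^n$ be the state set with unsafe set $X_u\subseteq X$, let $W\subset\mathbb{R}^L$ be the input set, and let $f(t,x,w)\in\mathbb{R}^n$ be the dynamics. $\mathcal{W}$ is the class of (measurable) functions $w:[0,T]\to W$. $x(t\mid x',w(\cdot))$ is the state at time $t$ of the trajectory of $\dot x(t)=f(t,x(t),w(t))$ with $x(0)=x'$. $J:W\to\mathbb{R}$ is a control cost and $J_{\max}\in[0,\infty)$. Define $Z=[0,J_{\max}]$, $\Omega=\{(w,z)\in W\times Z: J(w)\le z\}$ (taken to be compact), and $\mathcal{L}_f v(t,x,z,w) = \partial_t v(t,x,z) + f(t,x,w)\cdot\nabla_x v(t,x,z)$. $\varphi$ is a probability distribution on $X$ (with easily computable moments, e.g. uniform on $X$ when $X$ is a ball or box), and $Q_{\max}\ge J_{\max}$ is a finite control cap. Standing assumptions (the initial condition is an arbitrary point $x'\in X$, i.e. the initial set is $X_0=\{x'\}$). A1: the sets $[0,T]$, $[0,J_{\max}]$, $X$, $W$, $X_u$ are all compact. A2: the image $f(t,x,W)$ is convex for each fixed $(t,x)$. A3: $f$ is Lipschitz on the compact domain $[0,T]\times X\times W$. A4: if $x(t\mid x',w)\in\partial X$ for some $t\in[0,T]$, $x'\in X$, $w\in\mathcal{W}$, then $x(s\mid x',w)\notin X$ for all $s\in(t,T]$. *)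

theory Defs
  imports "HOL-Probability.Probability"
begin

text \<open>
  Trajectories are Caratheodory solutions: absolutely continuous curves satisfying the differential
  equation almost everywhere. The members \<open>K\<close> of a division are compact intervals
  \<open>[Inf K, Sup K]\<close> with pairwise disjoint interiors, so the following is the usual
  epsilon-delta definition.
\<close>

definition abs_continuous_on :: "real set \<Rightarrow> (real \<Rightarrow> 'a::real_normed_vector) \<Rightarrow> bool" where
  "abs_continuous_on I x \<longleftrightarrow>
     (\<forall>\<epsilon>>0. \<exists>\<delta>>0. \<forall>D S. D division_of S \<and> S \<subseteq> I \<and> (\<Sum>K\<in>D. Sup K - Inf K) < \<delta>
        \<longrightarrow> (\<Sum>K\<in>D. norm (x (Sup K) - x (Inf K))) < \<epsilon>)"

definition admissible_controls ::
    "real \<Rightarrow> 'w::euclidean_space set \<Rightarrow> (real \<Rightarrow> 'w) set" where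
  "admissible_controls T W =
     {w. w \<in> borel_measurable (lebesgue_on {0..T}) \<and> (\<forall>t\<in>{0..T}. w t \<in> W)}"

text \<open>
  Since \<open>f\<close> is regular only on \<open>X\<close>, a solution need not extend to the whole horizon
  \<open>[0, T]\<close> once it has left \<open>X\<close>. Hence a trajectory carries its own final time
  \<open>\<tau>\<close>, and \<open>x t\<close> is the state reached at time \<open>t\<close> from
  \<open>x\<^sub>0\<close> under the control \<open>w\<close> for every \<open>t \<in> [0, \<tau>]\<close>.
\<close>

definition trajectory ::
    "(real \<Rightarrow> 'x \<Rightarrow> 'w \<Rightarrow> 'x) \<Rightarrow> real \<Rightarrow> 'x::euclidean_space \<Rightarrow> (real \<Rightarrow> 'w) \<Rightarrow> (real \<Rightarrow> 'x) \<Rightarrow> bool" where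
  "trajectory f \<tau> x\<^sub>0 w x \<longleftrightarrow>
     x 0 = x\<^sub>0 \<and> abs_continuous_on {0..\<tau>} x \<and>
     (AE t in lebesgue_on {0..\<tau>}.
        (x has_vector_derivative f t (x t) (w t)) (at t within {0..\<tau>}))"

definition Omega :: "'w set \<Rightarrow> ('w \<Rightarrow> real) \<Rightarrow> real \<Rightarrow> ('w \<times> real) set" where
  "Omega W J Jmax = {(w, z). w \<in> W \<and> z \<in> {0..Jmax} \<and> J w \<le> z}"

definition V_fun ::
    "(real \<Rightarrow> 'x \<Rightarrow> 'w \<Rightarrow> 'x) \<Rightarrow> real \<Rightarrow> 'x::euclidean_space set \<Rightarrow> 'w::euclidean_space set \<Rightarrow>
     ('w \<Rightarrow> real) \<Rightarrow> real \<Rightarrow> 'x \<Rightarrow> real \<Rightarrow> ereal" where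
  "V_fun f T Xu W J Jmax x' z =
     (if z \<in> {0..Jmax} \<and>
         (\<exists>t\<in>{0..T}. \<exists>w\<in>admissible_controls T W. \<exists>x.
            trajectory f t x' w x \<and> x t \<in> Xu \<and> (\<forall>t'\<in>{0..t}. J (w t') \<le> z))
      then ereal z else \<infinity>)"

definition Q_fun ::
    "(real \<Rightarrow> 'x \<Rightarrow> 'w \<Rightarrow> 'x) \<Rightarrow> real \<Rightarrow> 'x::euclidean_space set \<Rightarrow> 'w::euclidean_space set \<Rightarrow>
     ('w \<Rightarrow> real) \<Rightarrow> real \<Rightarrow> 'x \<Rightarrow> ereal" where
  "Q_fun f T Xu W J Jmax x' = (INF z\<in>{0..Jmax}. V_fun f T Xu W J Jmax x' z)"

text \<open>
  Continuous differentiability on a set that need not be open: \<open>g\<close> is a continuous gradient of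
  \<open>v\<close> relative to \<open>K\<close>. The restriction to \<open>K\<close> of a function that is
  continuously differentiable on a neighbourhood of \<open>K\<close>, together with its gradient,
  is a special case.
\<close>

definition C1_on_with_gradient ::
    "'a::euclidean_space set \<Rightarrow> ('a \<Rightarrow> real) \<Rightarrow> ('a \<Rightarrow> 'a) \<Rightarrow> bool" where
  "C1_on_with_gradient K v g \<longleftrightarrow>
     continuous_on K g \<and> (\<forall>p\<in>K. (v has_derivative (\<lambda>h. g p \<bullet> h)) (at p within K))"

text \<open>
  The Lie derivative of \<open>v\<close> along \<open>f\<close>, where \<open>g\<close> is the gradient of
  \<open>v\<close>, with components \<open>(\<partial>\<^sub>t v, \<nabla>\<^sub>x v, \<partial>\<^sub>z v)\<close>.
\<close>

definition lie_derivative ::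
    "(real \<Rightarrow> 'x \<Rightarrow> 'w \<Rightarrow> 'x) \<Rightarrow> (real \<times> 'x::euclidean_space \<times> real \<Rightarrow> real \<times> 'x \<times> real) \<Rightarrow>
     real \<Rightarrow> 'x \<Rightarrow> real \<Rightarrow> 'w \<Rightarrow> real" where
  "lie_derivative f g t x z w =
     (case g (t, x, z) of (v\<^sub>t, v\<^sub>x, v\<^sub>z) \<Rightarrow> v\<^sub>t + f t x w \<bullet> v\<^sub>x)"

definition measure_support :: "'a::topological_space measure \<Rightarrow> 'a set" where
  "measure_support \<phi> = {x. \<forall>U. open U \<and> x \<in> U \<longrightarrow> emeasure \<phi> U > 0}"

text \<open>
  The feasible pairs of the program. If \<open>[0, T] \<times> X \<times> [0, Jmax]\<close> is thin
  in some direction, the gradient of \<open>v\<close> relative to this set is not unique; it is then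
  enough that one choice satisfies the Lie derivative constraint.
\<close>

definition feasible ::
    "(real \<Rightarrow> 'x \<Rightarrow> 'w \<Rightarrow> 'x) \<Rightarrow> real \<Rightarrow> 'x::euclidean_space set \<Rightarrow> 'x set \<Rightarrow> 'w set \<Rightarrow>
     ('w \<Rightarrow> real) \<Rightarrow> real \<Rightarrow> real \<Rightarrow> 'x measure \<Rightarrow>
     (('x \<Rightarrow> real) \<times> (real \<times> 'x \<times> real \<Rightarrow> real)) set" where
  "feasible f T X Xu W J Jmax Qmax \<phi> =
     {(q, v).
        continuous_on X q \<and>
        (\<forall>x\<in>X. \<forall>z\<in>{0..Jmax}. q x \<le> v (0, x, z)) \<and>
        (\<forall>x\<in>measure_support \<phi>. q x \<le> Qmax) \<and>
        (\<forall>t\<in>{0..T}. \<forall>x\<in>Xu. \<forall>z\<in>{0..Jmax}. v (t, x, z) \<le> z) \<and>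
        (\<exists>g. C1_on_with_gradient ({0..T} \<times> X \<times> {0..Jmax}) v g \<and>
             (\<forall>t\<in>{0..T}. \<forall>x\<in>X. \<forall>(w, z)\<in>Omega W J Jmax. lie_derivative f g t x z w \<ge> 0))}"

text \<open>
  The optimal value of the program. The subvalue property concerns all feasible pairs,
  whatever their objective.
\<close>

definition program_value ::
    "(real \<Rightarrow> 'x \<Rightarrow> 'w \<Rightarrow> 'x) \<Rightarrow> real \<Rightarrow> 'x::euclidean_space set \<Rightarrow> 'x set \<Rightarrow> 'w set \<Rightarrow>
     ('w \<Rightarrow> real) \<Rightarrow> real \<Rightarrow> real \<Rightarrow> 'x measure \<Rightarrow> ereal" where
  "program_value f T X Xu W J Jmax Qmax \<phi> =
     (SUP (q, v)\<in>feasible f T X Xu W J Jmax Qmax \<phi>. ereal (LINT x:X|\<phi>. q x))"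

end

theory Submission
  imports Defs
begin

text \<open>
  If \<open>Q x'\<close> is finite, it is an infimum of levels \<open>z\<close> for which some trajectory \<open>x\<close>
  from \<open>x'\<close> reaches \<open>X\<^sub>u\<close> at a time \<open>t\<close> with control cost at most \<open>z\<close> on the way. Along
  such a trajectory the three constraints chain together:
  \<open>q x' \<le> v (0, x', z) \<le> v (t, x t, z) \<le> z\<close>. The outer inequalities are constraints of the
  program, and the middle one integrates the Lie derivative constraint. Two points need care.

  The Lie derivative is controlled on \<open>X\<close> only, so the trajectory must be in \<open>X\<close> up to time
  \<open>t\<close>. Were it to leave \<open>X\<close>, it would do so through the boundary and could not be in \<open>X\<close>
  again, but \<open>x t \<in> X\<^sub>u \<subseteq> X\<close> (lemma \<open>no_return_imp_stays\<close>).

  Trajectories are merely absolutely continuous, and \<open>v\<close> is differentiable relative to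
  \<open>[0, T] \<times> X \<times> [0, Jmax]\<close>, where \<open>X\<close> is an arbitrary compact set. Such a \<open>v\<close> need not be
  Lipschitz there, since two nearby points of \<open>X\<close> may not be joined by a short path inside \<open>X\<close>;
  so \<open>v\<close> composed with the curve is not absolutely continuous for the usual reason. Around each
  single point, however, the increments of \<open>v\<close> are at most a constant times the distance to that
  point, and the constant is uniform because the gradient is bounded on a compact set
  (lemma \<open>C1_on_compact_pointwise_lipschitz\<close>). This suffices for monotonicity by a gauge
  argument (lemma \<open>nondecreasing_if_dominated_and_derivative_nonneg_ae\<close>): in a fine tagged
  division, the intervals tagged at points of nonnegative derivative contribute almost no decrease,
  and those tagged in the exceptional null set have so small a total length that the curve hardly
  moves on them.
\<close>

section \<open>Absolutely continuous curves\<close>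

lemma abs_continuous_on_imp_continuous_on:
  fixes x :: "real \<Rightarrow> 'a::real_normed_vector"
  assumes "abs_continuous_on {a..b} x"
  shows "continuous_on {a..b} x"
  unfolding continuous_on_iff
proof (intro ballI allI impI)
  fix s e :: real
  assume s: "s \<in> {a..b}" and "e > 0"
  with assms obtain d where d: "d > 0" "\<And>D S. D division_of S \<Longrightarrow> S \<subseteq> {a..b} \<Longrightarrow>
      (\<Sum>K\<in>D. Sup K - Inf K) < d \<Longrightarrow> (\<Sum>K\<in>D. norm (x (Sup K) - x (Inf K))) < e"
    unfolding abs_continuous_on_def by meson
  have "dist (x u) (x s) < e" if u: "u \<in> {a..b}" "dist u s < d" for u
  proof -
    have "{{min u s..max u s}} division_of {min u s..max u s}"
      by (rule division_of_self[of "min u s" "max u s", simplified cbox_interval]) auto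
    moreover have "{min u s..max u s} \<subseteq> {a..b}"
      using s u by auto
    ultimately have "norm (x (max u s) - x (min u s)) < e"
      using d(2)[of "{{min u s..max u s}}" "{min u s..max u s}"] u
      by (auto simp: dist_real_def max_def min_def split: if_splits)
    then show ?thesis
      by (auto simp: dist_norm max_def min_def norm_minus_commute split: if_splits)
  qed
  with d(1) show "\<exists>d>0. \<forall>u\<in>{a..b}. dist u s < d \<longrightarrow> dist (x u) (x s) < e"
    by blast
qed

text \<open>
  Absolute continuity for families of intervals instead of sets of intervals. The intervals cut out
  of a tagged division at its tags form such a family, in which degenerate intervals may be repeated;
  they contribute nothing and are discarded, after which the family is injective.
\<close>

lemma abs_continuous_on_indexed:
  fixes x :: "real \<Rightarrow> 'a::real_normed_vector"
  assumes "abs_continuous_on {a..b} x" and "\<epsilon> > 0"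
  shows "\<exists>\<delta>>0. \<forall>(P :: 'i set) l r. finite P \<and> (\<forall>i\<in>P. a \<le> l i \<and> l i \<le> r i \<and> r i \<le> b) \<and>
      disjoint_family_on (\<lambda>i. {l i<..<r i}) P \<and> (\<Sum>i\<in>P. r i - l i) < \<delta> \<longrightarrow>
      (\<Sum>i\<in>P. norm (x (r i) - x (l i))) < \<epsilon>"
proof -
  obtain d where d: "d > 0" "\<And>D S. D division_of S \<Longrightarrow> S \<subseteq> {a..b} \<Longrightarrow>
      (\<Sum>K\<in>D. Sup K - Inf K) < d \<Longrightarrow> (\<Sum>K\<in>D. norm (x (Sup K) - x (Inf K))) < \<epsilon>"
    using assms unfolding abs_continuous_on_def by meson
  have "(\<Sum>i\<in>P. norm (x (r i) - x (l i))) < \<epsilon>"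
    if fin: "finite P" and lr: "\<forall>i\<in>P. a \<le> l i \<and> l i \<le> r i \<and> r i \<le> b"
      and disj_fam: "disjoint_family_on (\<lambda>i. {l i<..<r i}) P"
      and len: "(\<Sum>i\<in>P. r i - l i) < d" for P :: "'i set" and l r
  proof -
    have disj: "{l i<..<r i} \<inter> {l j<..<r j} = {}" if "i \<in> P" "j \<in> P" "i \<noteq> j" for i j
      using disjoint_family_onD[OF disj_fam that] .
    define A where "A = {i\<in>P. l i < r i}"
    define I where "I = (\<lambda>i. {l i..r i})"
    have inj: "inj_on I A"
    proof (rule inj_onI, rule ccontr)
      fix i j assume ij: "i \<in> A" "j \<in> A" "I i = I j" "i \<noteq> j"
      then have "l i = l j" "r i = r j"
        by (auto simp: I_def A_def Icc_eq_Icc)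
      with ij disj[of i j] show False
        using dense[of "l j" "r j"] by (auto simp: A_def)
    qed
    have "I ` A division_of \<Union>(I ` A)"
    proof (rule division_ofI)
      show "finite (I ` A)" using fin by (simp add: A_def)
    next
      fix K K' assume "K \<in> I ` A" "K' \<in> I ` A" "K \<noteq> K'"
      then obtain i j where ij: "i \<in> P" "j \<in> P" "i \<noteq> j" "K = {l i..r i}" "K' = {l j..r j}"
        by (auto simp: I_def A_def)
      show "interior K \<inter> interior K' = {}"
        unfolding ij(4,5) interior_atLeastAtMost_real by (rule disj[OF ij(1-3)])
    next
      fix K assume "K \<in> I ` A"
      then obtain i where "i \<in> A" "K = {l i..r i}" by (auto simp: I_def)
      then show "K \<noteq> {}" "\<exists>a b. K = cbox a b"
        by (auto simp: A_def cbox_interval)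
      show "K \<subseteq> \<Union>(I ` A)" using \<open>K \<in> I ` A\<close> by blast
    qed auto
    moreover have "\<Union>(I ` A) \<subseteq> {a..b}"
      using lr by (force simp: I_def A_def)
    moreover have "(\<Sum>K\<in>I ` A. F (Sup K) (Inf K)) = (\<Sum>i\<in>P. F (r i) (l i))"
      if "\<And>s. F s s = 0" for F :: "real \<Rightarrow> real \<Rightarrow> real"
    proof -
      have "(\<Sum>K\<in>I ` A. F (Sup K) (Inf K)) = (\<Sum>i\<in>A. F (Sup (I i)) (Inf (I i)))"
        by (simp add: sum.reindex[OF inj])
      also have "\<dots> = (\<Sum>i\<in>A. F (r i) (l i))"
        by (intro sum.cong) (auto simp: I_def A_def)
      also have "\<dots> = (\<Sum>i\<in>P. F (r i) (l i))"
      proof (intro sum.mono_neutral_left fin ballI)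
        fix i assume "i \<in> P - A"
        then have "r i = l i" using lr by (auto simp: A_def)
        then show "F (r i) (l i) = 0" using that by simp
      qed (auto simp: A_def)
      finally show ?thesis .
    qed
    from this[of "\<lambda>s t. s - t"] this[of "\<lambda>s t. norm (x s - x t)"]
    have "(\<Sum>K\<in>I ` A. Sup K - Inf K) = (\<Sum>i\<in>P. r i - l i)"
      "(\<Sum>K\<in>I ` A. norm (x (Sup K) - x (Inf K))) = (\<Sum>i\<in>P. norm (x (r i) - x (l i)))"
      by simp_all
    ultimately show ?thesis
      using d(2)[of "I ` A" "\<Union>(I ` A)"] len by simp
  qed
  with d(1) show ?thesis by blast
qed

text \<open>
  The function \<open>v\<close> lives on time, state and cost level; this is the curve along which it is
  evaluated.
\<close>

lemma abs_continuous_on_graph: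
  fixes x :: "real \<Rightarrow> 'a::real_normed_vector" and c :: "'b::real_normed_vector"
  assumes "abs_continuous_on I x"
  shows "abs_continuous_on I (\<lambda>s. (s, x s, c))"
  unfolding abs_continuous_on_def
proof (intro allI impI)
  fix e :: real assume "e > 0"
  then have "e / 2 > 0" by simp
  with assms obtain d where d: "d > 0" "\<And>D S. D division_of S \<Longrightarrow> S \<subseteq> I \<Longrightarrow>
      (\<Sum>K\<in>D. Sup K - Inf K) < d \<Longrightarrow> (\<Sum>K\<in>D. norm (x (Sup K) - x (Inf K))) < e / 2"
    unfolding abs_continuous_on_def by meson
  have "(\<Sum>K\<in>D. norm ((Sup K, x (Sup K), c) - (Inf K, x (Inf K), c))) < e"
    if D: "D division_of S" "S \<subseteq> I" "(\<Sum>K\<in>D. Sup K - Inf K) < min d (e / 2)" for D S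
  proof -
    have "norm ((Sup K, x (Sup K), c) - (Inf K, x (Inf K), c))
          \<le> (Sup K - Inf K) + norm (x (Sup K) - x (Inf K))" if K: "K \<in> D" for K
    proof -
      obtain l r where "K = {l..r}" "K \<noteq> {}"
        using division_ofD(3,4)[OF D(1) K] by (auto simp: cbox_interval)
      then have "Inf K \<le> Sup K" by simp
      then show ?thesis
        using norm_Pair_le[of "Sup K - Inf K" "(x (Sup K) - x (Inf K), 0::'b)"] by simp
    qed
    then have "(\<Sum>K\<in>D. norm ((Sup K, x (Sup K), c) - (Inf K, x (Inf K), c)))
        \<le> (\<Sum>K\<in>D. (Sup K - Inf K) + norm (x (Sup K) - x (Inf K)))"
      by (rule sum_mono)
    also have "\<dots> < e / 2 + e / 2"
      using d(2)[OF D(1,2)] D(3) by (simp add: sum.distrib)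
    finally show ?thesis by simp
  qed
  with d(1) \<open>e > 0\<close> show "\<exists>\<delta>>0. \<forall>D S. D division_of S \<and> S \<subseteq> I \<and> (\<Sum>K\<in>D. Sup K - Inf K) < \<delta> \<longrightarrow>
      (\<Sum>K\<in>D. norm ((Sup K, x (Sup K), c) - (Inf K, x (Inf K), c))) < e"
    by (intro exI[of _ "min d (e / 2)"]) auto
qed

section \<open>Monotonicity from a derivative that is nonnegative almost everywhere\<close>

lemma nonneg_derivative_lower_bound:
  fixes h :: "real \<Rightarrow> real"
  assumes "(h has_real_derivative m) (at s within S)" "m \<ge> 0" "\<epsilon> > 0"
  shows "\<exists>\<rho>>0. \<forall>u\<in>S. \<bar>u - s\<bar> < \<rho> \<longrightarrow>
    (s \<le> u \<longrightarrow> h u - h s \<ge> - \<epsilon> * (u - s)) \<and>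
    (u \<le> s \<longrightarrow> h s - h u \<ge> - \<epsilon> * (s - u))"
proof -
  obtain \<rho> where "\<rho> > 0" and
    bnd: "\<And>u. u \<in> S \<Longrightarrow> \<bar>u - s\<bar> < \<rho> \<Longrightarrow> \<bar>h u - h s - m * (u - s)\<bar> \<le> \<epsilon> * \<bar>u - s\<bar>"
    using assms(1,3) unfolding has_field_derivative_def has_derivative_within_alt by force
  show ?thesis
  proof (intro exI conjI ballI impI, rule \<open>\<rho> > 0\<close>)
    fix u assume u: "u \<in> S" "\<bar>u - s\<bar> < \<rho>"
    show "h u - h s \<ge> - \<epsilon> * (u - s)" if "s \<le> u"
    proof -
      have "0 \<le> m * (u - s)" using assms(2) that by simp
      then show ?thesis using bnd[OF u] that by simp
    qed
    show "h s - h u \<ge> - \<epsilon> * (s - u)" if "u \<le> s"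
    proof -
      have "0 \<le> m * (s - u)" using assms(2) that by simp
      moreover have "\<bar>h u - h s + m * (s - u)\<bar> \<le> \<epsilon> * (s - u)"
        using bnd[OF u] that by (simp add: algebra_simps)
      ultimately show ?thesis by simp
    qed
  qed
qed

text \<open>
  The domination hypothesis compares \<open>h\<close> at \<open>s\<close> with its values near \<open>s\<close> only, in a
  neighbourhood that depends on \<open>s\<close>. This is why the estimate is carried out on the two halves
  into which a tag splits its interval: on both, \<open>h\<close> is compared with its value at the tag.
  Let \<open>\<epsilon> > 0\<close>. Intervals with tag outside \<open>N\<close> lose at most \<open>\<epsilon>\<close> times their length.
  The indicator of \<open>N\<close> has integral 0, so a fine enough division has total length of the
  intervals with tag in \<open>N\<close> below any prescribed bound, and absolute continuity makes the
  increments of \<open>y\<close> on their left halves, and likewise on their right halves, sum to less than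
  \<open>\<epsilon>\<close>. Altogether the loss is at most \<open>\<epsilon> * ((b - a) + 2 * L)\<close>.
\<close>

lemma nondecreasing_if_dominated_and_derivative_nonneg_ae:
  fixes h :: "real \<Rightarrow> real" and y :: "real \<Rightarrow> 'a::real_normed_vector"
  assumes "a \<le> b" and ac: "abs_continuous_on {a..b} y" and "L > 0"
    and dom: "\<And>s. s \<in> {a..b} \<Longrightarrow>
        \<forall>\<^sub>F u in at s within {a..b}. \<bar>h u - h s\<bar> \<le> L * norm (y u - y s)"
    and N: "negligible N"
    and der: "\<And>s. s \<in> {a..b} - N \<Longrightarrow>
        \<exists>m\<ge>0. (h has_real_derivative m) (at s within {a..b})"
  shows "h a \<le> h b"
proof -
  have "h a - h b \<le> \<epsilon> * ((b - a) + 2 * L)" if "\<epsilon> > 0" for \<epsilon>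
  proof -
    obtain \<delta> where \<delta>: "\<delta> > 0"
      and ac': "\<forall>(P :: (real \<times> real set) set) l r. finite P \<and>
        (\<forall>i\<in>P. a \<le> l i \<and> l i \<le> r i \<and> r i \<le> b) \<and>
        disjoint_family_on (\<lambda>i. {l i<..<r i}) P \<and> (\<Sum>i\<in>P. r i - l i) < \<delta> \<longrightarrow>
        (\<Sum>i\<in>P. norm (y (r i) - y (l i))) < \<epsilon>"
      using abs_continuous_on_indexed[OF ac \<open>\<epsilon> > 0\<close>] by blast
    \<comment> \<open>First gauge: the intervals tagged in \<open>N\<close> have total length below \<open>\<delta>\<close>.\<close>
    have ind: "(indicat_real N has_integral 0) (cbox a b)"
      using N unfolding negligible_def by (elim allE)
    have "\<exists>\<gamma>. gauge \<gamma> \<and> (\<forall>p. p tagged_division_of cbox a b \<and> \<gamma> fine p \<longrightarrow>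
        norm ((\<Sum>(s, K)\<in>p. measure lborel K *\<^sub>R indicat_real N s) - 0) < \<delta>)"
      by (rule has_integral[THEN iffD1, rule_format, OF ind \<delta>])
    then obtain \<gamma> where \<gamma>: "gauge \<gamma>" and \<gamma>_small: "\<forall>p. p tagged_division_of cbox a b \<and> \<gamma> fine p \<longrightarrow>
        norm ((\<Sum>(s, K)\<in>p. measure lborel K *\<^sub>R indicat_real N s) - 0) < \<delta>"
      by blast
    \<comment> \<open>Second gauge: the radius within which a tag controls the increments of \<open>h\<close>.\<close>
    define good where "good s u \<longleftrightarrow> \<bar>h u - h s\<bar> \<le> L * norm (y u - y s) \<and>
        (s \<notin> N \<longrightarrow> (s \<le> u \<longrightarrow> h u - h s \<ge> - \<epsilon> * (u - s)) \<and>
                   (u \<le> s \<longrightarrow> h s - h u \<ge> - \<epsilon> * (s - u)))" for s u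
    have "\<exists>\<rho>>0. s \<in> {a..b} \<longrightarrow> (\<forall>u\<in>{a..b}. \<bar>u - s\<bar> < \<rho> \<longrightarrow> good s u)" for s
    proof (cases "s \<in> {a..b}")
      case True
      obtain \<rho>1 where \<rho>1: "\<rho>1 > 0" "\<And>u. u \<in> {a..b} \<Longrightarrow> u \<noteq> s \<Longrightarrow> dist u s < \<rho>1 \<Longrightarrow>
          \<bar>h u - h s\<bar> \<le> L * norm (y u - y s)"
        using dom[OF True] unfolding eventually_at by blast
      have dom': "\<bar>h u - h s\<bar> \<le> L * norm (y u - y s)" if "u \<in> {a..b}" "\<bar>u - s\<bar> < \<rho>1" for u
        using \<rho>1(2)[of u] that by (cases "u = s") (auto simp: dist_real_def)
      show ?thesis
      proof (cases "s \<in> N")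
        case True
        then have "good s u" if "u \<in> {a..b}" "\<bar>u - s\<bar> < \<rho>1" for u
          using dom'[OF that] by (simp add: good_def)
        with \<rho>1(1) show ?thesis by blast
      next
        case False
        then obtain m where m: "m \<ge> 0" "(h has_real_derivative m) (at s within {a..b})"
          using der \<open>s \<in> {a..b}\<close> by blast
        obtain \<rho>2 where \<rho>2: "\<rho>2 > 0" "\<forall>u\<in>{a..b}. \<bar>u - s\<bar> < \<rho>2 \<longrightarrow>
            (s \<le> u \<longrightarrow> h u - h s \<ge> - \<epsilon> * (u - s)) \<and>
            (u \<le> s \<longrightarrow> h s - h u \<ge> - \<epsilon> * (s - u))"
          using nonneg_derivative_lower_bound[OF m(2,1) \<open>\<epsilon> > 0\<close>] by blast
        have "good s u" if "u \<in> {a..b}" "\<bar>u - s\<bar> < min \<rho>1 \<rho>2" for u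
          using dom'[of u] bspec[OF \<rho>2(2) that(1)] that by (simp add: good_def)
        with \<rho>1(1) \<rho>2(1) show ?thesis
          by (intro exI[of _ "min \<rho>1 \<rho>2"]) simp
      qed
    qed (auto intro: exI[of _ 1])
    then obtain \<rho> where \<rho>: "\<And>s. \<rho> s > 0"
      and near: "\<And>s u. s \<in> {a..b} \<Longrightarrow> u \<in> {a..b} \<Longrightarrow> \<bar>u - s\<bar> < \<rho> s \<Longrightarrow> good s u"
      by metis
    have "gauge (\<lambda>s. \<gamma> s \<inter> ball s (\<rho> s))"
      using \<gamma> \<rho> by (intro gauge_Int gauge_ball_dependent) auto
    then obtain p where p: "p tagged_division_of {a..b}" and fine: "(\<lambda>s. \<gamma> s \<inter> ball s (\<rho> s)) fine p"
      using fine_division_exists_real by blast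
    have p_fin: "finite p"
      by (rule tagged_division_of_finite[OF p])
    define l where "l = (\<lambda>i::real \<times> real set. Inf (snd i))"
    define r where "r = (\<lambda>i::real \<times> real set. Sup (snd i))"
    have K: "snd i = {l i..r i} \<and> fst i \<in> {l i..r i} \<and> a \<le> l i \<and> r i \<le> b" if i: "i \<in> p" for i
    proof -
      have i': "(fst i, snd i) \<in> p" using i by simp
      obtain c d where "snd i = {c..d}"
        using tagged_division_ofD(4)[OF p i'] by (auto simp: cbox_interval)
      moreover have "fst i \<in> snd i" "snd i \<subseteq> {a..b}"
        using tagged_division_ofD(2,3)[OF p i'] by auto
      ultimately show ?thesis by (auto simp: l_def r_def)
    qed
    have K_disj: "{l i<..<r i} \<inter> {l j<..<r j} = {}" if "i \<in> p" "j \<in> p" "i \<noteq> j" for i j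
    proof -
      have "interior (snd i) \<inter> interior (snd j) = {}"
        using that tagged_division_ofD(5)[OF p, of "fst i" "snd i" "fst j" "snd j"] by (auto simp: prod_eq_iff)
      then show ?thesis using K that by simp
    qed
    have K_near: "\<bar>u - fst i\<bar> < \<rho> (fst i)" if "i \<in> p" "u \<in> {l i..r i}" for i u
    proof -
      have "snd i \<subseteq> ball (fst i) (\<rho> (fst i))"
        using fine that(1) unfolding fine_def by (cases i) force
      then show ?thesis using that K[of i] by (auto simp: dist_real_def)
    qed
    \<comment> \<open>The intervals on which only the domination by \<open>y\<close> is available.\<close>
    define M where "M = {i\<in>p. fst i \<in> N}"
    have M_fin: "finite M" and M_sub: "M \<subseteq> p"
      using p_fin by (auto simp: M_def)
    have "\<gamma> fine p"
      using fine unfolding fine_def by blast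
    with \<gamma>_small p have "\<bar>\<Sum>(s, K)\<in>p. measure lborel K * indicat_real N s\<bar> < \<delta>"
      by (auto simp: cbox_interval)
    also have "(\<Sum>(s, K)\<in>p. measure lborel K * indicat_real N s) = (\<Sum>i\<in>p. if fst i \<in> N then r i - l i else 0)"
    proof (rule sum.cong)
      fix i assume "i \<in> p"
      then have "measure lborel (snd i) = r i - l i"
        using K[of i] content_real[of "l i" "r i"] by simp
      then show "(case i of (s, K) \<Rightarrow> measure lborel K * indicat_real N s) = (if fst i \<in> N then r i - l i else 0)"
        by (simp add: case_prod_unfold)
    qed simp
    also have "\<dots> = (\<Sum>i\<in>M. r i - l i)"
      unfolding M_def using p_fin by (simp add: sum.inter_filter)
    finally have M_len: "(\<Sum>i\<in>M. r i - l i) < \<delta>" by simp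
    \<comment> \<open>Used once with the left halves and once with the right halves, cut at the tags.\<close>
    have M_variation: "(\<Sum>i\<in>M. norm (y (r' i) - y (l' i))) < \<epsilon>"
      if sub: "\<And>i. i \<in> p \<Longrightarrow> l i \<le> l' i \<and> l' i \<le> r' i \<and> r' i \<le> r i" for l' r'
    proof (rule ac'[rule_format], intro conjI ballI)
      have "(\<Sum>i\<in>M. r' i - l' i) \<le> (\<Sum>i\<in>M. r i - l i)"
        using sub M_sub by (intro sum_mono diff_mono) auto
      with M_len show "(\<Sum>i\<in>M. r' i - l' i) < \<delta>" by simp
      show "disjoint_family_on (\<lambda>i. {l' i<..<r' i}) M"
        unfolding disjoint_family_on_def
      proof (intro ballI impI)
        fix i j assume ij: "i \<in> M" "j \<in> M" "i \<noteq> j"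
        then have "{l' i<..<r' i} \<subseteq> {l i<..<r i}" "{l' j<..<r' j} \<subseteq> {l j<..<r j}"
          using sub[of i] sub[of j] M_sub by auto
        with K_disj[of i j] ij M_sub show "{l' i<..<r' i} \<inter> {l' j<..<r' j} = {}" by blast
      qed
    next
      fix i assume "i \<in> M"
      with M_sub have "i \<in> p" by blast
      then show "a \<le> l' i" "l' i \<le> r' i" "r' i \<le> b"
        using K[of i] sub[of i] by auto
    qed (rule M_fin)
    define c where "c = (\<lambda>i. if fst i \<in> N
      then L * (norm (y (fst i) - y (l i)) + norm (y (r i) - y (fst i))) else 0)"
    have "h (l i) - h (r i) \<le> \<epsilon> * (r i - l i) + c i" if i: "i \<in> p" for i
    proof -
      have Ki: "fst i \<in> {a..b}" "l i \<in> {a..b}" "r i \<in> {a..b}" "l i \<le> fst i" "fst i \<le> r i"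
        using K[OF i] by auto
      note L = near[OF Ki(1,2) K_near[OF i]] and R = near[OF Ki(1,3) K_near[OF i]]
      show ?thesis
      proof (cases "fst i \<in> N")
        case True
        have "\<bar>h (l i) - h (fst i)\<bar> \<le> L * norm (y (fst i) - y (l i))"
          "\<bar>h (r i) - h (fst i)\<bar> \<le> L * norm (y (r i) - y (fst i))"
          using L R Ki by (simp_all add: good_def norm_minus_commute)
        moreover have "0 \<le> \<epsilon> * (r i - l i)" using Ki \<open>\<epsilon> > 0\<close> by simp
        ultimately show ?thesis using True by (simp add: c_def distrib_left)
      next
        case False
        then have "h (r i) - h (fst i) \<ge> - \<epsilon> * (r i - fst i)" "h (fst i) - h (l i) \<ge> - \<epsilon> * (fst i - l i)"
          using L R Ki False by (simp_all add: good_def)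
        then show ?thesis using False by (simp add: c_def algebra_simps)
      qed
    qed
    then have "(\<Sum>i\<in>p. h (l i) - h (r i)) \<le> (\<Sum>i\<in>p. \<epsilon> * (r i - l i) + c i)"
      by (rule sum_mono)
    moreover have "(\<Sum>i\<in>p. h (l i) - h (r i)) = h a - h b"
      using additive_tagged_division_1[OF \<open>a \<le> b\<close> p, of "\<lambda>s. - h s"]
      by (simp add: l_def r_def case_prod_unfold)
    moreover have "(\<Sum>i\<in>p. r i - l i) = b - a"
      using additive_tagged_division_1[OF \<open>a \<le> b\<close> p, of "\<lambda>s. s"]
      by (simp add: l_def r_def case_prod_unfold)
    moreover have "(\<Sum>i\<in>p. c i)
        = L * ((\<Sum>i\<in>M. norm (y (fst i) - y (l i))) + (\<Sum>i\<in>M. norm (y (r i) - y (fst i))))"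
      unfolding M_def c_def using p_fin
      by (simp flip: sum.inter_filter sum.distrib add: sum_distrib_left)
    moreover have "\<dots> \<le> L * (\<epsilon> + \<epsilon>)"
      using M_variation[of l fst] M_variation[of fst r] K \<open>L > 0\<close>
      by (intro mult_left_mono add_mono) (fastforce intro: less_imp_le)+
    ultimately have "h a - h b \<le> \<epsilon> * (b - a) + L * (\<epsilon> + \<epsilon>)"
      by (simp add: sum.distrib flip: sum_distrib_left)
    then show ?thesis by (simp add: algebra_simps)
  qed
  note bound = this
  show ?thesis
  proof (rule ccontr)
    assume "\<not> h a \<le> h b"
    define C where "C = (b - a) + 2 * L"
    have "C > 0" using \<open>a \<le> b\<close> \<open>L > 0\<close> by (simp add: C_def)
    \<comment> \<open>This choice of \<open>\<epsilon>\<close> turns the bound into \<open>h a - h b \<le> (h a - h b) / 2\<close>.\<close>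
    with bound[of "(h a - h b) / (2 * C)"] \<open>\<not> h a \<le> h b\<close> show False
      by (simp add: C_def[symmetric])
  qed
qed

section \<open>The subvalue function along a trajectory\<close>

text \<open>
  Only the increments from a fixed point \<open>p\<close> are bounded, and how near \<open>p'\<close> must be depends on
  \<open>p\<close>; the constant, a bound for the gradient plus one, does not.
\<close>

lemma C1_on_compact_pointwise_lipschitz:
  assumes "compact K" "C1_on_with_gradient K v g"
  obtains L where "L > 0"
    and "\<And>p. p \<in> K \<Longrightarrow> \<forall>\<^sub>F p' in at p within K. \<bar>v p' - v p\<bar> \<le> L * norm (p' - p)"
proof -
  have cont: "continuous_on K g"
    and der: "\<And>p. p \<in> K \<Longrightarrow> (v has_derivative (\<lambda>h. g p \<bullet> h)) (at p within K)"
    using assms(2) by (auto simp: C1_on_with_gradient_def)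
  have "bounded (g ` K)"
    using compact_continuous_image[OF cont assms(1)] by (rule compact_imp_bounded)
  then obtain B where B: "B > 0" "\<And>p. p \<in> K \<Longrightarrow> norm (g p) \<le> B"
    by (auto simp: bounded_pos)
  show ?thesis
  proof (rule that[of "B + 1"])
    fix p assume p: "p \<in> K"
    obtain d where d: "d > 0"
      "\<And>p'. p' \<in> K \<Longrightarrow> norm (p' - p) < d \<Longrightarrow> norm (v p' - v p - g p \<bullet> (p' - p)) \<le> 1 * norm (p' - p)"
      using der[OF p] zero_less_one unfolding has_derivative_within_alt by blast
    have "\<bar>v p' - v p\<bar> \<le> (B + 1) * norm (p' - p)" if p': "p' \<in> K" "norm (p' - p) < d" for p'
    proof -
      have "\<bar>g p \<bullet> (p' - p)\<bar> \<le> norm (g p) * norm (p' - p)"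
        by (rule Cauchy_Schwarz_ineq2)
      also have "\<dots> \<le> B * norm (p' - p)"
        using B(2)[OF p] by (rule mult_right_mono) simp
      finally show ?thesis using d(2)[OF p'] by (simp add: distrib_right)
    qed
    then show "\<forall>\<^sub>F p' in at p within K. \<bar>v p' - v p\<bar> \<le> (B + 1) * norm (p' - p)"
      unfolding eventually_at using d(1) by (auto simp: dist_norm intro!: exI[of _ d])
  qed (use B in simp)
qed

text \<open>
  At almost every time the chain rule gives \<open>v (s, x s, z)\<close> the Lie derivative of \<open>v\<close> as its
  derivative in \<open>s\<close>: the level \<open>z\<close> is constant along the curve, so \<open>\<partial>\<^sub>z v\<close> does not enter.
\<close>

lemma subvalue_nondecreasing_along_trajectory:
  fixes f :: "real \<Rightarrow> 'x::euclidean_space \<Rightarrow> 'w \<Rightarrow> 'x"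
  assumes X: "compact X" and t: "0 \<le> t" "t \<le> T"
    and traj: "trajectory f t x\<^sub>0 w x"
    and inX: "\<And>s. s \<in> {0..t} \<Longrightarrow> x s \<in> X" and z: "z \<in> {0..Jmax}"
    and C1: "C1_on_with_gradient ({0..T} \<times> X \<times> {0..Jmax}) v g"
    and lie: "\<And>s. s \<in> {0..t} \<Longrightarrow> lie_derivative f g s (x s) z (w s) \<ge> 0"
  shows "v (0, x\<^sub>0, z) \<le> v (t, x t, z)"
proof -
  define y where "y = (\<lambda>s. (s, x s, z))"
  define K where "K = {0..T} \<times> X \<times> {0..Jmax}"
  have yK: "y s \<in> K" if "s \<in> {0..t}" for s
    using inX[OF that] that t z by (auto simp: y_def K_def)
  have ac: "abs_continuous_on {0..t} y"
    unfolding y_def using traj by (intro abs_continuous_on_graph) (simp add: trajectory_def)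
  have cont: "continuous_on {0..t} y"
    by (rule abs_continuous_on_imp_continuous_on[OF ac])
  have "compact K" unfolding K_def using X by (intro compact_Times) auto
  then obtain L where L: "L > 0"
    "\<And>p. p \<in> K \<Longrightarrow> \<forall>\<^sub>F p' in at p within K. \<bar>v p' - v p\<bar> \<le> L * norm (p' - p)"
    using C1_on_compact_pointwise_lipschitz C1 unfolding K_def by blast
  define N where "N = {s\<in>{0..t}. \<not> (x has_vector_derivative f s (x s) (w s)) (at s within {0..t})}"
  have "negligible N"
  proof -
    obtain N' where "N' \<in> null_sets (lebesgue_on {0..t})" "N \<subseteq> N'"
      using traj by (auto simp: trajectory_def N_def eventually_ae_filter)
    then have "N' \<in> null_sets lebesgue"
      by (subst (asm) null_sets_restrict_space) auto
    with \<open>N \<subseteq> N'\<close> show ?thesis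
      using negligible_iff_null_sets negligible_subset by blast
  qed
  have "(\<lambda>s. v (y s)) 0 \<le> (\<lambda>s. v (y s)) t"
  proof (rule nondecreasing_if_dominated_and_derivative_nonneg_ae[OF t(1) ac L(1) _ \<open>negligible N\<close>])
    fix s assume s: "s \<in> {0..t}"
    have "\<forall>\<^sub>F p in at (y s) within K. \<bar>v p - v (y s)\<bar> \<le> L * norm (p - y s)"
      using L(2) yK[OF s] by blast
    then obtain d where d: "d > 0" "\<And>p. p \<in> K \<Longrightarrow> p \<noteq> y s \<Longrightarrow> dist p (y s) < d \<Longrightarrow>
        \<bar>v p - v (y s)\<bar> \<le> L * norm (p - y s)"
      unfolding eventually_at by blast
    have "(y \<longlongrightarrow> y s) (at s within {0..t})"
      using cont s by (simp add: continuous_on)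
    then have "\<forall>\<^sub>F u in at s within {0..t}. dist (y u) (y s) < d"
      using d(1) by (rule tendstoD)
    moreover have "\<forall>\<^sub>F u in at s within {0..t}. u \<in> {0..t}"
      by (simp add: eventually_at_filter)
    ultimately show "\<forall>\<^sub>F u in at s within {0..t}. \<bar>v (y u) - v (y s)\<bar> \<le> L * norm (y u - y s)"
    proof eventually_elim
      case (elim u)
      then show ?case using d(2)[of "y u"] yK[of u] by (cases "y u = y s") auto
    qed
  next
    fix s assume s: "s \<in> {0..t} - N"
    define y' where "y' = (1::real, f s (x s) (w s), 0::real)"
    have "(x has_vector_derivative f s (x s) (w s)) (at s within {0..t})"
      using s by (auto simp: N_def)
    then have "(y has_derivative (\<lambda>h. h *\<^sub>R y')) (at s within {0..t})"
      unfolding y_def y'_def has_vector_derivative_def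
      by (auto intro!: derivative_eq_intros)
    moreover have "(v has_derivative (\<lambda>h. g (y s) \<bullet> h)) (at (y s) within y ` {0..t})"
    proof (rule has_derivative_subset)
      show "(v has_derivative (\<lambda>h. g (y s) \<bullet> h)) (at (y s) within K)"
        using C1 yK[of s] s by (auto simp: C1_on_with_gradient_def K_def)
    qed (use yK in auto)
    ultimately have "((\<lambda>s. v (y s)) has_derivative (\<lambda>h. g (y s) \<bullet> (h *\<^sub>R y'))) (at s within {0..t})"
      by (rule has_derivative_in_compose)
    then have "((\<lambda>s. v (y s)) has_real_derivative (g (y s) \<bullet> y')) (at s within {0..t})"
      by (simp add: has_field_derivative_def mult.commute[of _ "g (y s) \<bullet> y'"] mult_commute_abs)
    moreover have "g (y s) \<bullet> y' = lie_derivative f g s (x s) z (w s)"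
      by (simp add: lie_derivative_def y_def y'_def inner_prod_def case_prod_unfold inner_commute)
    ultimately show "\<exists>m\<ge>0. ((\<lambda>s. v (y s)) has_real_derivative m) (at s within {0..t})"
      using lie s by (metis DiffD1)
  qed
  then show ?thesis using traj by (simp add: y_def trajectory_def)
qed

section \<open>Trajectories that reach the unsafe set stay in the state set\<close>

text \<open>
  If \<open>x s\<close> is outside \<open>X\<close>, the last time \<open>e < s\<close> with \<open>x e \<in> X\<close> is a boundary time, since
  from an interior point the curve could not leave at once. No return after \<open>e\<close> then contradicts
  \<open>x t \<in> X\<close>.
\<close>

lemma no_return_imp_stays:
  fixes x :: "real \<Rightarrow> 'a::euclidean_space"
  assumes "closed X" and cont: "continuous_on {0..t} x" and "x 0 \<in> X" "x t \<in> X"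
    and no_return: "\<And>e s. e \<in> {0..t} \<Longrightarrow> x e \<in> frontier X \<Longrightarrow> s \<in> {e<..t} \<Longrightarrow> x s \<notin> X"
    and s: "s \<in> {0..t}"
  shows "x s \<in> X"
proof (rule ccontr)
  assume out: "x s \<notin> X"
  define S where "S = {0..s} \<inter> x -` X"
  have cont_s: "continuous_on {0..s} x"
    using cont s by (rule_tac continuous_on_subset) auto
  then have "closed S" unfolding S_def
    by (rule continuous_closed_preimage) (use assms in auto)
  moreover have "bounded S" unfolding S_def by (rule bounded_Int) simp
  moreover have "S \<noteq> {}" using assms(3) s by (auto simp: S_def)
  ultimately obtain e where e: "e \<in> S" and e_max: "\<And>r. r \<in> S \<Longrightarrow> r \<le> e"
    using compact_attains_sup[of S] by (auto simp: compact_eq_bounded_closed)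
  have "e < s" using e out by (cases "e = s") (auto simp: S_def)
  have "x e \<notin> interior X"
  proof
    assume "x e \<in> interior X"
    moreover have "(x \<longlongrightarrow> x e) (at e within {0..s})"
      using cont_s e by (auto simp: S_def continuous_on)
    ultimately have "\<forall>\<^sub>F r in at e within {0..s}. x r \<in> interior X"
      by (intro topological_tendstoD) auto
    then obtain d where "d > 0" and d: "\<And>r. r \<in> {0..s} \<Longrightarrow> r \<noteq> e \<Longrightarrow> dist r e < d \<Longrightarrow> x r \<in> interior X"
      unfolding eventually_at by blast
    define r where "r = min s (e + d / 2)"
    have r: "r \<in> {0..s}" "e < r" "dist r e < d"
      using \<open>e < s\<close> \<open>d > 0\<close> e by (auto simp: r_def S_def dist_real_def min_def)
    then have "x r \<in> X" using d[of r] interior_subset by auto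
    with r e_max[of r] show False by (auto simp: S_def)
  qed
  moreover have "x e \<in> closure X"
    using e closure_subset by (auto simp: S_def)
  ultimately have "x e \<in> frontier X" by (simp add: frontier_def)
  with no_return[of e t] e \<open>e < s\<close> s assms(4) show False
    by (auto simp: S_def)
qed

section \<open>The subvalue property\<close>

theorem theorem6p2:
  fixes T Jmax Qmax :: real
    and X Xu :: "(real ^ 'n) set"
    and W :: "(real ^ 'L) set"
    and f :: "real \<Rightarrow> real ^ 'n \<Rightarrow> real ^ 'L \<Rightarrow> real ^ 'n"
    and J :: "real ^ 'L \<Rightarrow> real"
    and \<phi> :: "(real ^ 'n) measure"
    and q :: "real ^ 'n \<Rightarrow> real"
    and v :: "real \<times> (real ^ 'n) \<times> real \<Rightarrow> real"
  assumes "T > 0" and "Jmax \<ge> 0" and "Qmax \<ge> Jmax"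
    and "Xu \<subseteq> X"
    and "compact (Omega W J Jmax)"
    and "prob_space \<phi>" and "sets \<phi> = sets borel" and "measure \<phi> X = 1"
    and A1: "compact {0..T}" "compact {0..Jmax}" "compact X" "compact W" "compact Xu"
    and A2: "\<And>t x. t \<in> {0..T} \<Longrightarrow> x \<in> X \<Longrightarrow> convex (f t x ` W)"
    and A3: "\<exists>C. C-lipschitz_on ({0..T} \<times> X \<times> W) (\<lambda>(t, x, w). f t x w)"
    and A4: "\<And>\<tau> x' w x t s. \<tau> \<in> {0..T} \<Longrightarrow> x' \<in> X \<Longrightarrow> w \<in> admissible_controls T W \<Longrightarrow>
               trajectory f \<tau> x' w x \<Longrightarrow> t \<in> {0..\<tau>} \<Longrightarrow> x t \<in> frontier X \<Longrightarrow>
               s \<in> {t<..\<tau>} \<Longrightarrow> x s \<notin> X"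
    and "(q, v) \<in> feasible f T X Xu W J Jmax Qmax \<phi>"
  shows "\<forall>x\<in>X. ereal (q x) \<le> Q_fun f T Xu W J Jmax x"
proof
  fix x' assume x': "x' \<in> X"
  obtain g where q_le: "\<And>x z. x \<in> X \<Longrightarrow> z \<in> {0..Jmax} \<Longrightarrow> q x \<le> v (0, x, z)"
    and v_le: "\<And>t x z. t \<in> {0..T} \<Longrightarrow> x \<in> Xu \<Longrightarrow> z \<in> {0..Jmax} \<Longrightarrow> v (t, x, z) \<le> z"
    and C1: "C1_on_with_gradient ({0..T} \<times> X \<times> {0..Jmax}) v g"
    and lie: "\<And>t x w z. t \<in> {0..T} \<Longrightarrow> x \<in> X \<Longrightarrow> (w, z) \<in> Omega W J Jmax \<Longrightarrow>
        lie_derivative f g t x z w \<ge> 0"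
    using \<open>(q, v) \<in> feasible f T X Xu W J Jmax Qmax \<phi>\<close> unfolding feasible_def by blast
  have "ereal (q x') \<le> V_fun f T Xu W J Jmax x' z" if z: "z \<in> {0..Jmax}" for z
  proof (cases "\<exists>t\<in>{0..T}. \<exists>w\<in>admissible_controls T W. \<exists>x.
            trajectory f t x' w x \<and> x t \<in> Xu \<and> (\<forall>t'\<in>{0..t}. J (w t') \<le> z)")
    case True
    then obtain t w x where t: "t \<in> {0..T}" and w: "w \<in> admissible_controls T W"
      and traj: "trajectory f t x' w x" and hit: "x t \<in> Xu"
      and cost: "\<And>s. s \<in> {0..t} \<Longrightarrow> J (w s) \<le> z"
      by blast
    have "continuous_on {0..t} x" "x 0 = x'"
      using traj abs_continuous_on_imp_continuous_on by (auto simp: trajectory_def)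
    then have inX: "x s \<in> X" if "s \<in> {0..t}" for s
      using no_return_imp_stays[of X t x s] that x' hit \<open>Xu \<subseteq> X\<close> A4[OF t x' w traj]
        compact_imp_closed[OF A1(3)] by blast
    have "q x' \<le> v (0, x', z)"
      using q_le x' z by blast
    also have "\<dots> \<le> v (t, x t, z)"
    proof (rule subvalue_nondecreasing_along_trajectory[OF A1(3) _ _ traj inX z C1])
      fix s assume s: "s \<in> {0..t}"
      with t w cost z have "(w s, z) \<in> Omega W J Jmax"
        by (auto simp: Omega_def admissible_controls_def)
      with s t inX show "lie_derivative f g s (x s) z (w s) \<ge> 0"
        by (intro lie) auto
    qed (use t in auto)
    also have "\<dots> \<le> z"
      using v_le t hit z by blast
    finally show ?thesis using z True by (simp add: V_fun_def)
  next
    case False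
    then show ?thesis unfolding V_fun_def by (simp only: simp_thms if_False) simp
  qed
  then show "ereal (q x') \<le> Q_fun f T Xu W J Jmax x'"
    unfolding Q_fun_def by (rule INF_greatest)
qed

end
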